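(* Fix a reference probability measure $P$ on $\mathbb{R}$ with cumulative distribution function $F$ and fix a tilting parameter $\lambda>0$. Let $Q^*_{\lambda,a^*}$ be the maximizer of the problem $$V_\varepsilon:=\max_{Q\in\mathcal Q_\varepsilon}\ \min_{\gamma\in\Pi(P,Q)}\ \mathbb{P}_\gamma(Y>X)>\tfrac12,$$ where $\mathcal Q_\varepsilon=\{Q\ll P:\ D_{\mathrm{KL}}(Q\Vert P)\le\varepsilon\}$, and let $G^*_{\lambda,a^*}$ be the cumulative distribution function of $Q^*_{\lambda,a^*}$. Then $G^*_{\lambda,a^*}$ dominates $F$ in the first-order sense, that is, $$F(x)\ge G^*_{\lambda,a^*}(x)\quad\text{for all }x\in\mathbb{R}.$$
   Context: $\varepsilon>0$ is the radius of the Kullback–Leibler ball, and $D_{\mathrm{KL}}(Q\Vert P)=\int\log\frac{dQ}{dP}\,dQ$. $\Pi(P,Q)$ is the set of Borel probability measures $\gamma$ on $\mathbb{R}^2$ whose first marginal (the law of $X$) is $P$ and whose second marginal (the law of $Y$) is $Q$, and $\mathbb{P}_\gamma(Y>X)=\int_{\mathbb{R}^2}I_{\{y>x\}}\,d\gamma(x,y)$, with $I$ denoting an indicator function. The requirement "$>\tfrac12$" in the display is part of how the problem is posed: only the case where the max–min value exceeds one half is of interest. Notation: for $\lambda>0$ and $a\in\mathbb{R}$, $Q_{\lambda,a}$ denotes the exponentially tilted measure with density $$\frac{dQ_{\lambda,a}}{dP}(x)=\frac{\exp[-I_{\{x\le a\}}/\lambda]}{Z(\lambda,a)},\qquad Z(\lambda,a)=1-(1-e^{-1/\lambda})F(a),$$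 and $G_{\lambda,a}$ denotes its cumulative distribution function. The subscripts in $Q^*_{\lambda,a^*}$ indicate that the maximizer is understood to be of this form, with multiplier $\lambda$ and threshold $a=a^*$. When the multiplier $\lambda$ is held fixed, $a^*$ denotes a maximiser over $a\in\mathbb{R}$ of $\phi_\lambda(a)=F(a)-G_{\lambda,a}(a)$, the objective of the associated fixed-$\lambda$ dual. *)

theory Defs
  imports "HOL-Probability.Probability"
begin

definition couplings :: "real measure \<Rightarrow> real measure \<Rightarrow> (real \<times> real) measure set" where
  "couplings P Q = {\<gamma>. prob_space \<gamma> \<and> sets \<gamma> = sets borel \<and>
     distr \<gamma> borel fst = P \<and> distr \<gamma> borel snd = Q}"

(* The Bochner integral in KL_divergence is 0 when the log-density is not Q-integrable.  Since
   the negative part of log (dQ/dP) is always Q-integrable, non-integrability means that the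
   divergence is infinite; the integrability clause therefore says exactly that it is finite. *)
definition KL_ball :: "real measure \<Rightarrow> real \<Rightarrow> real measure set" where
  "KL_ball P \<epsilon> = {Q. real_distribution Q \<and> absolutely_continuous P Q \<and>
     integrable Q (entropy_density (exp 1) P Q) \<and> KL_divergence (exp 1) P Q \<le> \<epsilon>}"

(* The infimum is a minimum: {y > x} is open, so its probability is lower semicontinuous in the
   coupling for weak convergence, and the set of couplings is nonempty and weakly compact. *)
definition min_prob_greater :: "real measure \<Rightarrow> real measure \<Rightarrow> real" where
  "min_prob_greater P Q = (INF \<gamma>\<in>couplings P Q. measure \<gamma> {(x, y). y > x})"

definition is_maximin_solution :: "real measure \<Rightarrow> real \<Rightarrow> real measure \<Rightarrow> bool" where
  "is_maximin_solution P \<epsilon> Q \<longleftrightarrow> is_arg_max (min_prob_greater P) (\<lambda>Q'. Q' \<in> KL_ball P \<epsilon>) Q"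

definition maximin_value :: "real measure \<Rightarrow> real \<Rightarrow> real" where
  "maximin_value P \<epsilon> = (SUP Q\<in>KL_ball P \<epsilon>. min_prob_greater P Q)"

definition tilt_const :: "real measure \<Rightarrow> real \<Rightarrow> real \<Rightarrow> real" where
  "tilt_const P lam a = 1 - (1 - exp (- 1 / lam)) * cdf P a"

definition tilted :: "real measure \<Rightarrow> real \<Rightarrow> real \<Rightarrow> real measure" where
  "tilted P lam a =
     density P (\<lambda>x. ennreal (exp (- indicator {..a} x / lam) / tilt_const P lam a))"

definition dual_objective :: "real measure \<Rightarrow> real \<Rightarrow> real \<Rightarrow> real" where
  "dual_objective P lam a = cdf P a - cdf (tilted P lam a) a"

(* A maximiser of the dual objective for fixed lambda need not give a solution of the
   max-min problem.  For continuous F, with c = 1 - exp (-1/lambda), the former requires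
   1 - c F(a) = sqrt (1 - c) and the latter 1 - c F(a) = lambda c. *)
definition is_dual_threshold :: "real measure \<Rightarrow> real \<Rightarrow> real \<Rightarrow> bool" where
  "is_dual_threshold P lam a \<longleftrightarrow> is_arg_max (dual_objective P lam) (\<lambda>_. True) a"

end

theory Submission
  imports Defs
begin

text \<open>
  First-order dominance comes from the tilting itself, whatever the threshold \<open>a\<close>: moving mass
  from \<open>{..a}\<close> to its complement in proportion to \<open>P\<close> can only lower the distribution function.
  Write \<open>F\<close> for the distribution function of \<open>P\<close> and \<open>c = 1 - exp (- 1 / \<lambda>)\<close>, so that
  \<open>0 < c < 1\<close>. On \<open>{..a}\<close> the density of the tilted
  measure with respect to \<open>P\<close> is \<open>(1 - c) / Z\<close>, and beyond \<open>a\<close> it is \<open>1 / Z\<close>; hence its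
  distribution function is \<open>G x = (F x - c * F (min x a)) / Z\<close> with \<open>Z = 1 - c * F a > 0\<close>.
  Clearing the denominator, \<open>G x \<le> F x\<close> amounts to \<open>F x * F a \<le> F (min x a)\<close>, which holds
  because the smaller of two numbers in \<open>[0, 1]\<close> bounds their product: the events \<open>{..x}\<close> and
  \<open>{..a}\<close> are nested, hence positively correlated under \<open>P\<close>.
\<close>

text \<open>The normalising constant is a convex combination of the two unnormalised weights
  \<open>1\<close> and \<open>exp (- 1 / \<lambda>)\<close>, both positive.\<close>

lemma tilt_const_pos:
  assumes "real_distribution P"
  shows "tilt_const P lam a > 0"
proof -
  interpret real_distribution P by fact
  have "tilt_const P lam a = (1 - cdf P a) * 1 + cdf P a * exp (- 1 / lam)"
    by (simp add: tilt_const_def algebra_simps)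
  moreover have "0 \<le> cdf P a" "cdf P a \<le> 1"
    by (simp_all add: cdf_nonneg cdf_bounded_prob)
  ultimately show ?thesis
    by (cases "cdf P a = 0") (simp_all add: add_nonneg_pos)
qed

lemma cdf_tilted:
  assumes "real_distribution P"
  shows "cdf (tilted P lam a) x =
    (cdf P x - (1 - exp (- 1 / lam)) * cdf P (min x a)) / tilt_const P lam a"
proof -
  interpret real_distribution P by fact
  define c where "c = 1 - exp (- 1 / lam)"
  define Z where "Z = tilt_const P lam a"
  have Z: "Z > 0"
    using tilt_const_pos[OF assms] by (simp add: Z_def)
  define f where "f = (\<lambda>y::real. exp (- indicator {..a} y / lam) / Z)"
  have f_meas: "f \<in> borel_measurable P"
    by (simp add: f_def)
  have tilted: "tilted P lam a = density P (\<lambda>y. ennreal (f y))"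
    by (simp add: tilted_def f_def Z_def)
  \<comment> \<open>The tilt takes only two values, so on \<open>{..x}\<close> the density is a combination of indicators.\<close>
  have f_ind: "f y * indicator {..x} y =
      (indicator {..x} y - c * indicator {..min x a} y) / Z" for y
    by (auto simp: f_def c_def indicator_def)
  have "cdf (tilted P lam a) x = (\<integral>y. indicator {..x} y \<partial>tilted P lam a)"
    by (simp add: cdf_def tilted)
  also have "\<dots> = (\<integral>y. f y * indicator {..x} y \<partial>P)"
    unfolding tilted using Z f_meas by (subst integral_real_density) (auto simp: f_def)
  also have "\<dots> = (\<integral>y. (indicator {..x} y - c * indicator {..min x a} y) / Z \<partial>P)"
    by (simp only: f_ind)
  also have "\<dots> = (cdf P x - c * cdf P (min x a)) / Z"
    by (simp add: cdf_def emeasure_eq_measure)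
  finally show ?thesis
    by (simp add: c_def Z_def)
qed

lemma cdf_mult_le_cdf_min:
  assumes "real_distribution P"
  shows "cdf P x * cdf P a \<le> cdf P (min x a)"
proof -
  interpret real_distribution P by fact
  show ?thesis
    by (simp add: min_def cdf_nonneg cdf_bounded_prob mult_left_le mult_left_le_one_le)
qed

text \<open>With \<open>\<lambda> > 0\<close> mass is moved away from \<open>{..a}\<close>; a negative \<open>\<lambda>\<close> would reverse the inequality.\<close>

lemma cdf_tilted_le_cdf:
  assumes "real_distribution P" and "lam > 0"
  shows "cdf (tilted P lam a) x \<le> cdf P x"
proof -
  define c where "c = 1 - exp (- 1 / lam)"
  have "c \<ge> 0"
    using \<open>lam > 0\<close> by (simp add: c_def)
  then have "c * (cdf P x * cdf P a) \<le> c * cdf P (min x a)"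
    by (intro mult_left_mono cdf_mult_le_cdf_min assms)
  then have "cdf P x - c * cdf P (min x a) \<le> cdf P x * tilt_const P lam a"
    by (simp add: tilt_const_def c_def algebra_simps)
  then show ?thesis
    using tilt_const_pos[OF assms(1), of lam a]
    by (simp add: cdf_tilted[OF assms(1)] c_def pos_divide_le_eq)
qed

theorem proposition2p6:
  fixes P Q :: "real measure" and \<epsilon> lam a :: real
  assumes "real_distribution P"
    and "\<epsilon> > 0"
    and "lam > 0"
    and "Q = tilted P lam a"
  shows "(is_maximin_solution P \<epsilon> Q \<and> maximin_value P \<epsilon> > 1 / 2 \<longrightarrow> (\<forall>x. cdf P x \<ge> cdf Q x)) \<and>
         (is_dual_threshold P lam a \<longrightarrow> (\<forall>x. cdf P x \<ge> cdf Q x))"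
  using cdf_tilted_le_cdf[OF assms(1,3)] assms(4) by simp

end
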